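(* Let $X$ be a connected bipartite vertex-transitive graph of order $n$ that is regular of degree $d$. If there exists a semiregular subgroup $H\le \mathrm{Aut}(X)$ of order $\frac{n}{2d}$ such that the quotient graph $X_H$ is a simple graph isomorphic to the complete bipartite graph $K_{d,d}$, then $X$ is a $d$-RDR graph.
   Context: All graphs are finite and simple. For a graph $G=(V,E)$, $N(v)$ is the open neighbourhood of $v$. Let $\mathcal K=\{1,\dots,k\}$. A $k$-rainbow dominating function ($k$-RDF) on $G$ is a map $f\colon V\to 2^{\mathcal K}$ such that $f(v)=\emptyset$ implies $\bigcup_{u\in N(v)}f(u)=\mathcal K$, for all $v\in V$. Its weight is $\sum_{v\in V}|f(v)|$, and $\gamma_{rk}(G)$ is the minimum weight of a $k$-RDF on $G$. It is known that a $d$-regular graph $G$ of order $n$ satisfies $\gamma_{rd}(G)\ge n/2$; it is called $d$-rainbow domination regular ($d$-RDR) if $\gamma_{rd}(G)=n/2$. A graph is vertex-transitive if its automorphism group acts transitively on its vertices. A subgroup $H\le\mathrm{Aut}(X)$ is semiregular if only the identity of $H$ fixes a vertex. The quotient graph $X_H$ has as vertices the orbits of $H$ on $V(X)$, two orbits being adjacent if there is an edge of $X$ with one endpoint in each of them. *)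

theory Defs
  imports "Graph_Theory.Graph_Theory" "HOL-Algebra.Group_Action"
begin

text \<open>
  A finite simple graph is a \<^locale>\<open>pair_graph\<close>: a finite, loop-free digraph without parallel arcs
  whose arc relation is symmetric, each edge being represented by its two arcs.
\<close>

definition neighbourhood :: "'a pair_pre_digraph \<Rightarrow> 'a \<Rightarrow> 'a set" where
  "neighbourhood G v = {u. (v, u) \<in> parcs G}"

definition regular_graph :: "nat \<Rightarrow> 'a pair_pre_digraph \<Rightarrow> bool" where
  "regular_graph d G \<longleftrightarrow> pair_graph G \<and> (\<forall>v \<in> pverts G. card (neighbourhood G v) = d)"

definition bipartite_graph :: "'a pair_pre_digraph \<Rightarrow> bool" where
  "bipartite_graph G \<longleftrightarrow> pair_graph G \<and>
     (\<exists>A B. pverts G = A \<union> B \<and> A \<inter> B = {} \<and> parcs G \<subseteq> A \<times> B \<union> B \<times> A)"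


text \<open>
  Only the values of \<open>f\<close> on the vertex set matter; the colour set is \<open>{1..k}\<close>.
\<close>

definition rainbow_dominating :: "nat \<Rightarrow> 'a pair_pre_digraph \<Rightarrow> ('a \<Rightarrow> nat set) \<Rightarrow> bool" where
  "rainbow_dominating k G f \<longleftrightarrow>
     (\<forall>v \<in> pverts G. f v \<subseteq> {1..k}) \<and>
     (\<forall>v \<in> pverts G. f v = {} \<longrightarrow> (\<Union>u \<in> neighbourhood G v. f u) = {1..k})"

definition rainbow_weight :: "'a pair_pre_digraph \<Rightarrow> ('a \<Rightarrow> nat set) \<Rightarrow> nat" where
  "rainbow_weight G f = (\<Sum>v \<in> pverts G. card (f v))"

text \<open>
  The minimum is always attained, since the constant function \<open>{1..k}\<close> is rainbow dominating.
\<close>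

definition rainbow_domination_number :: "nat \<Rightarrow> 'a pair_pre_digraph \<Rightarrow> nat" where
  "rainbow_domination_number k G =
     (LEAST w. \<exists>f. rainbow_dominating k G f \<and> rainbow_weight G f = w)"

definition rainbow_domination_regular :: "nat \<Rightarrow> 'a pair_pre_digraph \<Rightarrow> bool" where
  "rainbow_domination_regular d G \<longleftrightarrow> regular_graph d G \<and>
     real (rainbow_domination_number d G) = real (card (pverts G)) / 2"


text \<open>
  As in \<^const>\<open>BijGroup\<close>, automorphisms are functions on the vertex set that are undefined outside
  of it, so that the group has the right cardinality.
\<close>

definition aut_group :: "'a pair_pre_digraph \<Rightarrow> ('a \<Rightarrow> 'a) monoid" where
  "aut_group G = BijGroup (pverts G)
     \<lparr>carrier := {g \<in> Bij (pverts G).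
        \<forall>u \<in> pverts G. \<forall>v \<in> pverts G. (g u, g v) \<in> parcs G \<longleftrightarrow> (u, v) \<in> parcs G}\<rparr>"

definition vertex_transitive :: "'a pair_pre_digraph \<Rightarrow> bool" where
  "vertex_transitive G \<longleftrightarrow>
     (\<forall>u \<in> pverts G. \<forall>v \<in> pverts G. \<exists>g \<in> carrier (aut_group G). g u = v)"

definition semiregular_subgroup :: "('a \<Rightarrow> 'a) set \<Rightarrow> 'a pair_pre_digraph \<Rightarrow> bool" where
  "semiregular_subgroup H G \<longleftrightarrow> subgroup H (aut_group G) \<and>
     (\<forall>g \<in> H. (\<exists>v \<in> pverts G. g v = v) \<longrightarrow> g = \<one>\<^bsub>aut_group G\<^esub>)"

definition vertex_orbits :: "'a pair_pre_digraph \<Rightarrow> ('a \<Rightarrow> 'a) set \<Rightarrow> 'a set set" where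
  "vertex_orbits G H = orbits ((aut_group G)\<lparr>carrier := H\<rparr>) (pverts G) (\<lambda>g. g)"

text \<open>
  An edge of \<open>G\<close> inside an orbit yields a loop of the quotient, so the quotient need not be a
  simple graph.
\<close>

definition quotient_graph :: "'a pair_pre_digraph \<Rightarrow> ('a \<Rightarrow> 'a) set \<Rightarrow> 'a set pair_pre_digraph" where
  "quotient_graph G H =
     \<lparr>pverts = vertex_orbits G H,
      parcs = {(A, B). A \<in> vertex_orbits G H \<and> B \<in> vertex_orbits G H \<and>
                 (\<exists>u \<in> A. \<exists>v \<in> B. (u, v) \<in> parcs G)}\<rparr>"

end

theory Submission
  imports Defs
begin

text \<open>
  In a \<open>d\<close>-regular graph with \<open>d > 0\<close>, the vertices with a nonempty label number at most the weight, and
  so do the vertices with an empty label, since each of those sees at least \<open>d\<close> colours while each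
  colour is seen by \<open>d\<close> vertices. Hence the weight is at least half the order. Equality is attained as
  follows: an edge between two \<open>H\<close>-orbits can be translated by \<open>H\<close> to start at any vertex of the first
  one, so if the quotient is complete bipartite, every vertex over one side has a neighbour in each
  of the \<open>d\<close> orbits over the other. Label the vertices over that other side with their orbit, and the rest
  with the empty set.
\<close>

lemma neighbourhood_eq_sides:
  assumes "pverts G = P \<union> Q" "P \<inter> Q = {}" "parcs G \<subseteq> P \<times> Q \<union> Q \<times> P" "v \<in> P"
  shows "neighbourhood G v = {u \<in> Q. (v, u) \<in> parcs G}"
  using assms by (auto simp: neighbourhood_def)

context pair_graph
begin

lemma sym_arc: "(u, v) \<in> parcs G \<longleftrightarrow> (v, u) \<in> parcs G"
  using pair_sym_arcs by (auto simp: symmetric_def dest: symD)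

lemma finite_neighbourhood: "finite (neighbourhood G v)"
  by (rule finite_subset[OF _ pair_finite_verts]) (auto simp: neighbourhood_def dest: in_arcsD2)

text \<open>Selecting from a fixed vertex set by an arc condition is the form in which a double sum
  over adjacent pairs can be exchanged.\<close>

lemma neighbourhood_converse:
  "neighbourhood G v = {u \<in> pverts G. (u, v) \<in> parcs G}"
  by (auto simp: neighbourhood_def sym_arc dest: in_arcsD1 in_arcsD2)

end

lemma regular_rainbow_weight_ge:
  assumes reg: "regular_graph d G" and d: "d > 0" and dom: "rainbow_dominating d G f"
  shows "card (pverts G) \<le> 2 * rainbow_weight G f"
proof -
  interpret pair_graph G using reg by (simp add: regular_graph_def)
  let ?E = "{v \<in> pverts G. f v = {}}" and ?F = "{v \<in> pverts G. f v \<noteq> {}}"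
  have fin: "finite (f v)" if "v \<in> pverts G" for v
    using dom that by (auto simp: rainbow_dominating_def intro: finite_subset)
  have "card ?F = (\<Sum>v\<in>?F. 1)" by simp
  also have "\<dots> \<le> (\<Sum>v\<in>?F. card (f v))"
    by (rule sum_mono) (auto simp: fin Suc_le_eq card_gt_0_iff)
  also have "\<dots> \<le> rainbow_weight G f"
    unfolding rainbow_weight_def by (rule sum_mono2) (auto simp: pair_finite_verts)
  finally have F: "card ?F \<le> rainbow_weight G f" .
  \<comment> \<open>Around an unlabelled vertex all \<open>d\<close> colours occur, so by the union
    bound the neighbouring label sizes add up to at least \<open>d\<close>.\<close>
  have "d * card ?E = (\<Sum>v\<in>?E. d)" by simp
  also have "\<dots> \<le> (\<Sum>v\<in>?E. \<Sum>u\<in>neighbourhood G v. card (f u))"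
  proof (rule sum_mono)
    fix v assume "v \<in> ?E"
    then have "(\<Union>u\<in>neighbourhood G v. f u) = {1..d}"
      using dom by (simp add: rainbow_dominating_def)
    then show "d \<le> (\<Sum>u\<in>neighbourhood G v. card (f u))"
      using card_UN_le[OF finite_neighbourhood[of v], of f] by simp
  qed
  also have "\<dots> \<le> (\<Sum>v\<in>pverts G. \<Sum>u\<in>neighbourhood G v. card (f u))"
    by (rule sum_mono2) (auto simp: pair_finite_verts)
  \<comment> \<open>After the exchange, the label of \<open>u\<close> is counted once per neighbour
    of \<open>u\<close>, hence \<open>d\<close> times.\<close>
  also have "\<dots> = (\<Sum>u\<in>pverts G. \<Sum>v\<in>neighbourhood G u. card (f u))"
    unfolding neighbourhood_converse
    by (subst sum.swap_restrict[OF pair_finite_verts pair_finite_verts]) (simp add: sym_arc)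
  also have "\<dots> = d * rainbow_weight G f"
    using reg by (simp add: regular_graph_def rainbow_weight_def sum_distrib_left)
  finally have E: "card ?E \<le> rainbow_weight G f"
    using d by simp
  have "card (pverts G) = card (?E \<union> ?F)"
    by (rule arg_cong[where f = card]) auto
  also have "\<dots> \<le> card ?E + card ?F" by (rule card_Un_le)
  finally show ?thesis using E F by linarith
qed

text \<open>The lower bound applies to every competitor, so a function attaining it is a
  minimiser.\<close>

lemma rainbow_domination_regularI:
  assumes reg: "regular_graph d G" and d: "d > 0" and dom: "rainbow_dominating d G f"
    and weight: "2 * rainbow_weight G f = card (pverts G)"
  shows "rainbow_domination_regular d G"
proof -
  have "rainbow_domination_number d G = rainbow_weight G f"
    unfolding rainbow_domination_number_def
    using dom weight regular_rainbow_weight_ge[OF reg d] by (intro Least_equality) fastforce+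
  then show ?thesis
    using reg arg_cong[OF weight, of real] by (simp add: rainbow_domination_regular_def)
qed

text \<open>Double counting: the edges between the sides number \<open>d * card P\<close> counted
  from \<open>P\<close> and \<open>d * card Q\<close> counted from \<open>Q\<close>.\<close>

lemma regular_bipartite_card_eq:
  assumes reg: "regular_graph d G" and d: "d > 0"
    and sides: "pverts G = P \<union> Q" "P \<inter> Q = {}" "parcs G \<subseteq> P \<times> Q \<union> Q \<times> P"
  shows "card P = card Q"
proof -
  interpret pair_graph G using reg by (simp add: regular_graph_def)
  have fin: "finite P" "finite Q" using pair_finite_verts sides(1) by auto
  have nP: "{u \<in> Q. (v, u) \<in> parcs G} = neighbourhood G v" if "v \<in> P" for v
    using neighbourhood_eq_sides[OF sides that] by simp
  have nQ: "{u \<in> P. (u, v) \<in> parcs G} = neighbourhood G v" if "v \<in> Q" for v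
    using neighbourhood_eq_sides[of G Q P v] sides that by (auto simp: sym_arc[of _ v])
  have "(\<Sum>v\<in>P. card {u \<in> Q. (v, u) \<in> parcs G}) = d * card Q"
    using reg fin sides(1) by (intro sum_multicount) (auto simp: nQ regular_graph_def)
  moreover have "(\<Sum>v\<in>P. card {u \<in> Q. (v, u) \<in> parcs G}) = d * card P"
    using reg sides(1) by (simp add: nP regular_graph_def)
  ultimately show ?thesis using d by simp
qed

text \<open>Singleton labels on \<open>P\<close> and empty labels on \<open>Q\<close> give weight
  \<open>card P\<close>, which is half the order because the sides have equal size.\<close>

lemma rainbow_domination_regular_if_side_coloured:
  assumes reg: "regular_graph d G" and d: "d > 0"
    and sides: "pverts G = P \<union> Q" "P \<inter> Q = {}" "parcs G \<subseteq> P \<times> Q \<union> Q \<times> P"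
    and colour: "c ` P \<subseteq> {1..d}"
    and rainbow: "\<And>v. v \<in> Q \<Longrightarrow> {1..d} \<subseteq> c ` neighbourhood G v"
  shows "rainbow_domination_regular d G"
proof -
  define f where "f v = (if v \<in> P then {c v} else {})" for v
  interpret pair_graph G using reg by (simp add: regular_graph_def)
  have fin: "finite P" "finite Q" using pair_finite_verts sides(1) by auto
  have N: "neighbourhood G v \<subseteq> P" if "v \<in> Q" for v
    using sides that by (auto simp: neighbourhood_def)
  have "(\<Union>u\<in>neighbourhood G v. f u) = {1..d}" if "v \<in> Q" for v
  proof -
    have "(\<Union>u\<in>neighbourhood G v. f u) = c ` neighbourhood G v"
      using N[OF that] by (auto simp: f_def)
    moreover have "c ` neighbourhood G v \<subseteq> {1..d}"
      using image_mono[OF N[OF that]] colour by (rule subset_trans)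
    ultimately show ?thesis using rainbow[OF that] by simp
  qed
  then have "rainbow_dominating d G f"
    using sides(1) colour by (auto simp: rainbow_dominating_def f_def)
  moreover have "rainbow_weight G f = (\<Sum>v\<in>P. 1)"
    unfolding rainbow_weight_def
    by (rule sum.mono_neutral_cong_right) (auto simp: sides(1) fin f_def)
  then have "2 * rainbow_weight G f = card (pverts G)"
    using regular_bipartite_card_eq[OF reg d sides] card_Un_disjoint[OF fin sides(2)] sides(1) by simp
  ultimately show ?thesis by (rule rainbow_domination_regularI[OF reg d])
qed

text \<open>\<open>aut_group\<close> only replaces the carrier of \<open>BijGroup\<close>; closure
  of that carrier has to be proved before subgroups of it can act.\<close>

lemma subgroup_carrier_aut_group: "subgroup (carrier (aut_group G)) (BijGroup (pverts G))"
proof (rule group.subgroupI[OF group_BijGroup])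
  show "carrier (aut_group G) \<subseteq> carrier (BijGroup (pverts G))"
    by (auto simp: aut_group_def BijGroup_def)
  have "(\<lambda>v\<in>pverts G. v) \<in> carrier (aut_group G)"
    by (simp add: aut_group_def id_Bij)
  then show "carrier (aut_group G) \<noteq> {}" by blast
next
  fix g assume "g \<in> carrier (aut_group G)"
  then have g: "g \<in> Bij (pverts G)"
    and arcs: "\<And>u v. u \<in> pverts G \<Longrightarrow> v \<in> pverts G \<Longrightarrow> (g u, g v) \<in> parcs G \<longleftrightarrow> (u, v) \<in> parcs G"
    by (auto simp: aut_group_def)
  \<comment> \<open>The arc condition for the inverse is the one for \<open>g\<close>, read at the
    preimages of \<open>u\<close> and \<open>v\<close>.\<close>
  have "g (inv_into (pverts G) g v) = v" if "v \<in> pverts G" for v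
    using g that by (auto simp: Bij_def bij_betw_def intro: f_inv_into_f)
  then have "(inv_into (pverts G) g u, inv_into (pverts G) g v) \<in> parcs G \<longleftrightarrow> (u, v) \<in> parcs G"
    if "u \<in> pverts G" "v \<in> pverts G" for u v
    using arcs[of "inv_into (pverts G) g u" "inv_into (pverts G) g v"] that
    by (simp add: Bij_inv_into_mem[OF g])
  then show "inv\<^bsub>BijGroup (pverts G)\<^esub> g \<in> carrier (aut_group G)"
    using g restrict_inv_into_Bij[OF g] by (simp add: inv_BijGroup aut_group_def)
next
  fix g h assume "g \<in> carrier (aut_group G)" "h \<in> carrier (aut_group G)"
  moreover from this have "h v \<in> pverts G" if "v \<in> pverts G" for v
    using that by (auto simp: aut_group_def dest: Bij_imp_funcset[THEN funcset_mem])
  ultimately show "g \<otimes>\<^bsub>BijGroup (pverts G)\<^esub> h \<in> carrier (aut_group G)"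
    by (simp add: aut_group_def BijGroup_def compose_Bij compose_eq)
qed

text \<open>An action is a homomorphism into \<open>BijGroup\<close>. Elements of \<open>H\<close>
  already are permutations of the vertices, so inclusion serves once \<open>H\<close> is seen as a
  subgroup of \<open>BijGroup\<close>.\<close>

lemma group_action_aut_subgroup:
  assumes "subgroup H (aut_group G)"
  shows "group_action ((aut_group G)\<lparr>carrier := H\<rparr>) (pverts G) (\<lambda>g. g)"
proof -
  let ?B = "BijGroup (pverts G)"
  have aut: "aut_group G = ?B\<lparr>carrier := carrier (aut_group G)\<rparr>"
    by (simp add: aut_group_def)
  have "subgroup H (?B\<lparr>carrier := carrier (aut_group G)\<rparr>)"
    using assms aut by simp
  then have H: "subgroup H ?B"
    by (rule group.incl_subgroup[OF group_BijGroup subgroup_carrier_aut_group])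
  have "group_hom (?B\<lparr>carrier := H\<rparr>) ?B (\<lambda>g. g)"
    unfolding group_hom_def group_hom_axioms_def
    using subgroup.subgroup_is_group[OF H group_BijGroup] group_BijGroup subgroup.subset[OF H]
    by (auto simp: hom_def)
  moreover have "(aut_group G)\<lparr>carrier := H\<rparr> = ?B\<lparr>carrier := H\<rparr>"
    by (subst aut) simp
  ultimately show ?thesis by (simp add: group_action_def)
qed

text \<open>Some arc \<open>(a, b)\<close> witnesses the adjacency. An element of \<open>H\<close>
  taking \<open>a\<close> to \<open>v\<close> preserves arcs and keeps \<open>b\<close> inside its
  orbit \<open>B\<close>.\<close>

lemma adjacent_orbits_arc:
  assumes H: "subgroup H (aut_group G)" and arc: "(A, B) \<in> parcs (quotient_graph G H)" and v: "v \<in> A"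
  shows "\<exists>u\<in>B. (v, u) \<in> parcs G"
proof -
  interpret group_action "(aut_group G)\<lparr>carrier := H\<rparr>" "pverts G" "\<lambda>g. g"
    by (rule group_action_aut_subgroup[OF H])
  obtain a b where A: "A \<in> vertex_orbits G H" and B: "B \<in> vertex_orbits G H"
    and ab: "a \<in> A" "b \<in> B" "(a, b) \<in> parcs G"
    using arc by (auto simp: quotient_graph_def)
  have verts: "a \<in> pverts G" "b \<in> pverts G" "v \<in> pverts G"
    using orbits_coverture A B ab v by (auto simp: vertex_orbits_def)
  \<comment> \<open>Orbits that meet coincide, so an orbit is generated by any of its
    points.\<close>
  have orbit_eq: "C = orbit ((aut_group G)\<lparr>carrier := H\<rparr>) (\<lambda>g. g) x"
    if "C \<in> vertex_orbits G H" "x \<in> C" "x \<in> pverts G" for C x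
    using disjoint_union[of C "orbit ((aut_group G)\<lparr>carrier := H\<rparr>) (\<lambda>g. g) x"] orbit_refl[of x] that
    by (auto simp: vertex_orbits_def orbits_def)
  obtain g where g: "g \<in> H" "g a = v"
    using v orbit_eq[OF A ab(1) verts(1)] by (auto simp: orbit_def)
  have "g b \<in> B"
    using g(1) by (subst orbit_eq[OF B ab(2) verts(2)]) (auto simp: orbit_def)
  moreover have "(g a, g b) \<in> parcs G"
    using subgroup.subset[OF H] g(1) verts ab(3) by (auto simp: aut_group_def)
  ultimately show ?thesis using g(2) by auto
qed

theorem theorem3p2:
  fixes X :: "'a pair_pre_digraph" and n d :: nat
  assumes "pair_graph X"
    and "Digraph_Component.connected (with_proj X)"
    and "bipartite_graph X"
    and "vertex_transitive X"
    and "card (pverts X) = n"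
    and "regular_graph d X"
    and "\<exists>H. semiregular_subgroup H X \<and> real (card H) = real n / (2 * real d) \<and>
           pair_graph (quotient_graph X H) \<and>
           complete_bipartite_digraph d d (with_proj (quotient_graph X H))"
  shows "rainbow_domination_regular d X"
proof -
  interpret pair_graph X by (rule assms(1))
  obtain H where H: "subgroup H (aut_group X)"
    and K: "complete_bipartite_digraph d d (with_proj (quotient_graph X H))"
    using assms(7) by (auto simp: semiregular_subgroup_def)
  interpret act: group_action "(aut_group X)\<lparr>carrier := H\<rparr>" "pverts X" "\<lambda>g. g"
    by (rule group_action_aut_subgroup[OF H])
  let ?orb = "\<lambda>x. orbit ((aut_group X)\<lparr>carrier := H\<rparr>) (\<lambda>g. g) x"
  obtain U V where UV: "vertex_orbits X H = U \<union> V" "U \<inter> V = {}" "card U = d" "card V = d"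
    and arcs: "parcs (quotient_graph X H) = U \<times> V \<union> V \<times> U"
    and fin: "finite (vertex_orbits X H)"
    using K unfolding complete_bipartite_digraph_pair_def by (auto simp: quotient_graph_def)
  have orb: "?orb v \<in> vertex_orbits X H" "v \<in> ?orb v" if "v \<in> pverts X" for v
    using that act.orbit_refl by (auto simp: vertex_orbits_def orbits_def)
  have cover: "\<Union> (vertex_orbits X H) = pverts X"
    using act.orbits_coverture by (simp add: vertex_orbits_def)
  have disj: "C = D" if "C \<in> vertex_orbits X H" "D \<in> vertex_orbits X H" "v \<in> C" "v \<in> D" for C D v
    using act.disjoint_union[of C D] that by (auto simp: vertex_orbits_def)
  have orb_eq: "?orb v = C" if "C \<in> vertex_orbits X H" "v \<in> C" for C v
    using disj[of "?orb v" C v] orb that cover by blast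
  \<comment> \<open>Connectedness includes having a vertex. This yields an orbit, so one of
    \<open>U\<close> and \<open>V\<close> is nonempty, and both have size \<open>d\<close>.\<close>
  have "pverts X \<noteq> {}"
    using assms(2)
    by (auto simp: Digraph_Component.connected_def strongly_connected_def mk_symmetric_def)
  then have "U \<union> V \<noteq> {}" using cover UV(1) by auto
  then have d: "d > 0" using UV fin by (auto simp: card_gt_0_iff)
  have sides: "pverts X = \<Union>U \<union> \<Union>V" "\<Union>U \<inter> \<Union>V = {}"
    using cover UV(1,2) disj by blast+
  \<comment> \<open>Arcs of \<open>X\<close> project to arcs of the quotient, so the bipartition
    \<open>U\<close>, \<open>V\<close> of the orbits lifts to the vertices.\<close>
  have arcs_sides: "parcs X \<subseteq> \<Union>U \<times> \<Union>V \<union> \<Union>V \<times> \<Union>U"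
  proof
    fix e assume "e \<in> parcs X"
    then obtain u v where e: "e = (u, v)" "(u, v) \<in> parcs X" by (cases e) auto
    then have "u \<in> pverts X" "v \<in> pverts X" by (auto dest: in_arcsD1 in_arcsD2)
    note orbs = orb[OF this(1)] orb[OF this(2)]
    then have "(?orb u, ?orb v) \<in> parcs (quotient_graph X H)"
      using e(2) by (auto simp: quotient_graph_def)
    then show "e \<in> \<Union>U \<times> \<Union>V \<union> \<Union>V \<times> \<Union>U"
      using orbs e(1) arcs by auto
  qed
  have "finite U" using fin UV(1) by simp
  \<comment> \<open>The \<open>d\<close> orbits in \<open>U\<close> receive distinct colours; a
    vertex \<open>v\<close> over \<open>U\<close> inherits the colour
    \<open>k (?orb v)\<close>.\<close>
  then obtain k where k: "bij_betw k U {1..d}"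
    using UV(3) finite_same_card_bij[of U "{1..d}"] by auto
  have colour: "k (?orb v) = k C" if "C \<in> U" "v \<in> C" for C v
    using orb_eq[of C v] UV(1) that by simp
  show ?thesis
  proof (rule rainbow_domination_regular_if_side_coloured[OF assms(6) d sides arcs_sides])
    show "(\<lambda>v. k (?orb v)) ` \<Union>U \<subseteq> {1..d}"
      using colour bij_betw_imp_surj_on[OF k] by fastforce
  next
    fix v assume "v \<in> \<Union>V"
    then obtain B where B: "B \<in> V" "v \<in> B" by blast
    show "{1..d} \<subseteq> (\<lambda>v. k (?orb v)) ` neighbourhood X v"
    proof
      fix i assume "i \<in> {1..d}"
      \<comment> \<open>Colour \<open>i\<close> belongs to an orbit \<open>A\<close> in
        \<open>U\<close>. Completeness makes \<open>B\<close> adjacent to \<open>A\<close>, and this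
        adjacency lifts to an arc starting at \<open>v\<close> itself.\<close>
      then have "i \<in> k ` U" using bij_betw_imp_surj_on[OF k] by simp
      then obtain A where A: "A \<in> U" "k A = i" by blast
      then have "(B, A) \<in> parcs (quotient_graph X H)" using B arcs by auto
      then obtain u where "u \<in> A" "(v, u) \<in> parcs X"
        using adjacent_orbits_arc[OF H _ B(2)] by blast
      then show "i \<in> (\<lambda>v. k (?orb v)) ` neighbourhood X v"
        using colour[of A u] A by (auto simp: neighbourhood_def)
    qed
  qed
qed

end
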